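(* Let $\mathcal G$ be a connected weighted graph on $n$ nodes, and let $\mathcal P$ be a connected spanning subgraph of $\mathcal G$ (same node set, a subset of the edges, each with its weight in $\mathcal G$). Then $$\rho_{ss}(L_{\mathcal G};M_n)\ \le\ \rho_{ss}(L_{\mathcal P};M_n),$$ and equality holds if and only if $\mathcal G=\mathcal P$.
   Context: Graphs are finite, simple, undirected, with positive edge weights. For a connected weighted graph $\mathcal H$ on $n$ nodes, the Laplacian $L_{\mathcal H}$ is (diagonal matrix of weighted degrees) minus (weighted adjacency matrix), with eigenvalues $0=\lambda_1<\lambda_2\le\dots\le\lambda_n$. $M_n=I_n-\frac1nJ_n$ is the centering matrix, and $\rho_{ss}(L_{\mathcal H};M_n)=\frac12\sum_{i=2}^n\lambda_i^{-1}$ is the performance measure of the first-order consensus network $\dot x=-L_{\mathcal H}x+\xi$, $y=M_nx$. *)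

theory Defs
  imports "Jordan_Normal_Form.Char_Poly"
begin

text \<open>
  The node set of a graph on \<open>n\<close> nodes is \<open>{0..<n}\<close> and edges are unordered pairs of nodes.
  Weights are required to vanish off the edge set, so that two weighted graphs on \<open>n\<close> nodes are
  equal as records iff they have the same edges with the same weights.
\<close>

record wgraph =
  edges :: "nat set set"
  weight :: "nat set \<Rightarrow> real"

definition weighted_graph :: "nat \<Rightarrow> wgraph \<Rightarrow> bool" where
  "weighted_graph n G \<longleftrightarrow>
     edges G \<subseteq> {{u, v} | u v. u < n \<and> v < n \<and> u \<noteq> v} \<and>
     (\<forall>e \<in> edges G. 0 < weight G e) \<and>
     (\<forall>e. e \<notin> edges G \<longrightarrow> weight G e = 0)"

definition connected_graph :: "nat \<Rightarrow> wgraph \<Rightarrow> bool" where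
  "connected_graph n G \<longleftrightarrow>
     0 < n \<and> (\<forall>u < n. \<forall>v < n. (u, v) \<in> {(x, y). {x, y} \<in> edges G}\<^sup>*)"

definition spanning_subgraph :: "wgraph \<Rightarrow> wgraph \<Rightarrow> bool" where
  "spanning_subgraph P G \<longleftrightarrow>
     edges P \<subseteq> edges G \<and> (\<forall>e \<in> edges P. weight P e = weight G e)"

definition adjacency_mat :: "nat \<Rightarrow> wgraph \<Rightarrow> real mat" where
  "adjacency_mat n G =
     mat n n (\<lambda>(i, j). if {i, j} \<in> edges G then weight G {i, j} else 0)"

definition degree_mat :: "nat \<Rightarrow> wgraph \<Rightarrow> real mat" where
  "degree_mat n G = mat_diag n (\<lambda>i. \<Sum>e \<in> {e \<in> edges G. i \<in> e}. weight G e)"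

definition laplacian :: "nat \<Rightarrow> wgraph \<Rightarrow> real mat" where
  "laplacian n G = degree_mat n G - adjacency_mat n G"

text \<open>
  Eigenvalues in ascending order, repeated according to algebraic multiplicity. Only real
  eigenvalues are listed; a real symmetric matrix has no others, so in that case the list has
  length \<open>n\<close>.
\<close>

definition eigenvalue_list :: "real mat \<Rightarrow> real list" where
  "eigenvalue_list A = sorted_list_of_multiset (proots (char_poly A))"

text \<open>
  The performance measure \<open>\<rho>\<^sub>s\<^sub>s(L; M\<^sub>n)\<close> for the centering output matrix
  \<open>M\<^sub>n = I\<^sub>n - J\<^sub>n / n\<close>. List indices start at \<open>0\<close>, so \<open>\<lambda>\<^sub>i\<close> is entry \<open>i - 1\<close>.
\<close>

definition rho_ss_centered :: "real mat \<Rightarrow> real" where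
  "rho_ss_centered L = 1 / 2 * (\<Sum>i = 2..dim_row L. inverse (eigenvalue_list L ! (i - 1)))"

end

theory Submission
  imports Defs "Jordan_Normal_Form.Schur_Decomposition"
begin

text \<open>
  Adding edges to a graph makes its Laplacian larger as a quadratic form, and inversion of positive
  definite matrices reverses this order. Hence the trace of the inverse, which is the sum of the
  inverse eigenvalues, goes down. The Laplacian \<open>L\<close> itself is singular, so it is replaced by
  \<open>L + J\<close> with \<open>J\<close> the all-ones matrix: for a connected graph this matrix is
  positive definite, because the quadratic form of \<open>L\<close> vanishes only on constant vectors
  and that of \<open>J\<close> is the square of the coordinate sum.

  Passing from \<open>L\<close> to \<open>L + J\<close> changes the sum of inverse eigenvalues by a constant
  that depends on \<open>n\<close> alone. The reason is the identity
  \<open>(x I - L) (x I - J) = x (x I - (L + J))\<close>, valid because \<open>L J = 0\<close>: taking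
  determinants, the roots of the characteristic polynomials of \<open>L\<close> and \<open>J\<close> together
  are those of \<open>L + J\<close> and \<open>n\<close> zeros. With the convention that the inverse of
  \<open>0\<close> is \<open>0\<close>, all zero roots drop out of the sum of inverses
  (\<open>sum_inverse_roots_add_annihilating\<close>), which gives the formula
  \<open>rho_ss_centered_eq_trace\<close> for the performance measure.

  Strictness is read off from an exact formula. Let \<open>A\<close> and \<open>A + D\<close> have the inverses
  \<open>B\<close> and \<open>B'\<close>, and put \<open>X = D B'\<close>. Then
  \<open>B - B' = B' D B' + X\<^sup>T B X\<close>. Both terms have nonnegative trace, and since
  \<open>B\<close> is positive definite, the second trace vanishes only if \<open>X = 0\<close>, that is, only
  if \<open>D = 0\<close> (\<open>trace_inverse_antimono\<close>). Applied to the difference \<open>D\<close> of the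
  two Laplacians this yields the inequality and shows that equality forces equal Laplacians, hence
  equal graphs.
\<close>

section \<open>Trace of an inverse and eigenvalues of symmetric matrices\<close>

definition trace :: "'a :: comm_ring_1 mat \<Rightarrow> 'a" where
  "trace A = (\<Sum>i<dim_row A. A $$ (i, i))"

lemma trace_add:
  assumes "A \<in> carrier_mat n n" "B \<in> carrier_mat n n"
  shows "trace (A + B) = trace A + trace B"
  using assms by (simp add: trace_def sum.distrib)

lemma trace_mult_comm:
  assumes A: "A \<in> carrier_mat m n" and B: "B \<in> carrier_mat n m"
  shows "trace (A * B) = trace (B * A)"
proof -
  have "trace (A * B) = (\<Sum>i<m. \<Sum>k<n. A $$ (i, k) * B $$ (k, i))"
    using A B by (auto simp: trace_def scalar_prod_def atLeast0LessThan intro!: sum.cong)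
  also have "\<dots> = (\<Sum>k<n. \<Sum>i<m. B $$ (k, i) * A $$ (i, k))"
    by (subst sum.swap) (simp add: mult.commute)
  also have "\<dots> = trace (B * A)"
    using A B by (auto simp: trace_def scalar_prod_def atLeast0LessThan intro!: sum.cong)
  finally show ?thesis .
qed

text \<open>
  A congruence \<open>M\<^sup>T P M\<close> has the values of the quadratic form of \<open>P\<close> at the
  columns of \<open>M\<close> on its diagonal; this links definiteness with traces.
\<close>

lemma trace_transpose_mult:
  assumes M: "M \<in> carrier_mat n n" and P: "P \<in> carrier_mat n n"
  shows "trace (M\<^sup>T * (P * M)) = (\<Sum>i<n. col M i \<bullet> (P *\<^sub>v col M i))"
  using assms by (auto simp: trace_def mult_mat_vec_def intro!: sum.cong)

text \<open>
  Back substitution: comparing entries of \<open>T U = I\<close> below the diagonal, starting from the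
  last row, shows that \<open>U\<close> is upper triangular as well. Each diagonal entry of the product
  is then a single product of diagonal entries.
\<close>

lemma upper_triangular_inverse_diag:
  fixes T U :: "real mat"
  assumes T: "T \<in> carrier_mat n n" and U: "U \<in> carrier_mat n n"
    and tri: "upper_triangular T" and TU: "T * U = 1\<^sub>m n" and i: "i < n"
  shows "U $$ (i, i) = inverse (T $$ (i, i))"
proof -
  have entry: "(\<Sum>k<n. T $$ (i, k) * U $$ (k, j)) = (if i = j then 1 else 0)"
    if "i < n" "j < n" for i j
  proof -
    have "(T * U) $$ (i, j) = (\<Sum>k<n. T $$ (i, k) * U $$ (k, j))"
      using that T U by (auto simp: scalar_prod_def atLeast0LessThan intro!: sum.cong)
    thus ?thesis using that TU by simp
  qed
  have single: "(\<Sum>k<n. T $$ (i, k) * U $$ (k, j)) = T $$ (i, i) * U $$ (i, j)"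
    if "i < n" "\<forall>k. i < k \<longrightarrow> k < n \<longrightarrow> U $$ (k, j) = 0" for i j
  proof -
    have "T $$ (i, k) * U $$ (k, j) = 0" if "k < n" "k \<noteq> i" for k
      using that \<open>i < n\<close> \<open>\<forall>k. i < k \<longrightarrow> k < n \<longrightarrow> U $$ (k, j) = 0\<close> T tri
      by (cases "k < i") auto
    hence "(\<Sum>k<n. T $$ (i, k) * U $$ (k, j)) = (\<Sum>k\<in>{i}. T $$ (i, k) * U $$ (k, j))"
      using \<open>i < n\<close> by (intro sum.mono_neutral_right) auto
    thus ?thesis by simp
  qed
  have "prod_list (diag_mat T) \<noteq> 0"
    using det_mult[OF T U] TU det_upper_triangular[OF tri T] by (metis det_one mult_zero_left zero_neq_one)
  hence diag: "T $$ (i, i) \<noteq> 0" if "i < n" for i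
    using that T by (auto simp: prod_list_zero_iff diag_mat_def)
  have "\<forall>j<n. j < i \<longrightarrow> U $$ (i, j) = 0" if "i \<le> n" "i < n" for i
    using that
  proof (induction "n - i" arbitrary: i rule: less_induct)
    case less
    show ?case
    proof (intro allI impI)
      fix j assume j: "j < n" "j < i"
      have "U $$ (k, j) = 0" if "i < k" "k < n" for k
        using less.hyps[of k] less.prems that j by auto
      hence "T $$ (i, i) * U $$ (i, j) = 0"
        using single[of i j] entry[of i j] less.prems j by simp
      thus "U $$ (i, j) = 0" using diag less.prems by simp
    qed
  qed
  hence "T $$ (i, i) * U $$ (i, i) = 1"
    using single[of i i] entry[of i i] i by simp
  thus ?thesis by (metis inverse_unique)
qed

text \<open>
  A Schur decomposition \<open>A = P T Q\<close> has the roots on the diagonal of \<open>T\<close>, and the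
  conjugate \<open>Q B P\<close> of the inverse, which has the same trace as \<open>B\<close>, inverts
  \<open>T\<close>.
\<close>

lemma trace_inverse_eq_sum_inverse_roots:
  fixes A B :: "real mat"
  assumes A: "A \<in> carrier_mat n n" and B: "B \<in> carrier_mat n n" and AB: "A * B = 1\<^sub>m n"
    and split: "char_poly A = (\<Prod>e\<leftarrow>es. [:- e, 1:])"
  shows "trace B = (\<Sum>e\<leftarrow>es. inverse e)"
proof -
  obtain T P Q where schur: "schur_decomposition A es = (T, P, Q)"
    by (cases "schur_decomposition A es") auto
  have wit: "similar_mat_wit A T P Q" and tri: "upper_triangular T" and diag: "diag_mat T = es"
    using schur_decomposition[OF A split schur] by auto
  have T: "T \<in> carrier_mat n n" and P: "P \<in> carrier_mat n n" and Q: "Q \<in> carrier_mat n n"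
    and PQ: "P * Q = 1\<^sub>m n" and QP: "Q * P = 1\<^sub>m n" and eq: "A = P * T * Q"
    using wit A by (auto simp: similar_mat_wit_def Let_def)
  define U where "U = Q * B * P"
  have U: "U \<in> carrier_mat n n" using Q B P by (simp add: U_def)
  have "Q * A = T * Q"
  proof -
    have "Q * A = (Q * P) * (T * Q)"
      unfolding eq using P Q T by (simp add: assoc_mult_mat[of _ n n _ n _ n])
    thus ?thesis using QP T Q by simp
  qed
  have "T * U = (T * Q) * (B * P)"
    unfolding U_def using P Q T B by (simp add: assoc_mult_mat[of _ n n _ n _ n])
  also have "\<dots> = Q * ((A * B) * P)"
    unfolding \<open>Q * A = T * Q\<close>[symmetric]
    using P Q A B by (simp add: assoc_mult_mat[of _ n n _ n _ n])
  also have "\<dots> = 1\<^sub>m n" using AB QP P by simp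
  finally have TU: "T * U = 1\<^sub>m n" .
  have "trace B = trace ((P * Q) * B)" using PQ B by simp
  also have "\<dots> = trace (P * (Q * B))" using P Q B by (simp add: assoc_mult_mat[of _ n n _ n _ n])
  also have "\<dots> = trace U" unfolding U_def by (rule trace_mult_comm[of _ n n]) (use P Q B in auto)
  also have "\<dots> = (\<Sum>i<n. inverse (T $$ (i, i)))"
    using upper_triangular_inverse_diag[OF T U tri TU] U by (auto simp: trace_def)
  also have "\<dots> = (\<Sum>e\<leftarrow>diag_mat T. inverse e)"
    using T by (simp add: diag_mat_def comp_def interv_sum_list_conv_sum_set_nat atLeast0LessThan)
  finally show ?thesis unfolding diag .
qed

text \<open>
  For a complex eigenvector \<open>v\<close>, the number \<open>v\<^sup>* A v\<close> equals the eigenvalue times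
  the squared norm of \<open>v\<close>, and it is its own conjugate by the symmetry of \<open>A\<close>.
\<close>

lemma symmetric_eigenvalue_real:
  fixes A :: "real mat"
  assumes A: "A \<in> carrier_mat n n" and sym: "A\<^sup>T = A"
    and ev: "eigenvalue (map_mat complex_of_real A) k"
  shows "k \<in> \<real>"
proof -
  let ?C = "map_mat complex_of_real A"
  obtain v where v: "v \<in> carrier_vec n" "v \<noteq> 0\<^sub>v n" and Cv: "?C *\<^sub>v v = k \<cdot>\<^sub>v v"
    using ev A by (auto simp: eigenvalue_def eigenvector_def)
  have symm: "A $$ (i, j) = A $$ (j, i)" if "i < n" "j < n" for i j
    using that A arg_cong[OF sym, of "\<lambda>M. M $$ (i, j)"] by auto
  have row: "(\<Sum>j<n. complex_of_real (A $$ (i, j)) * v $ j) = k * v $ i" if "i < n" for i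
    using that A v arg_cong[OF Cv, of "\<lambda>w. w $ i"]
    by (auto simp: scalar_prod_def atLeast0LessThan)
  define S where "S = (\<Sum>i<n. cnj (v $ i) * v $ i)"
  define q where "q = (\<Sum>i<n. cnj (v $ i) * (\<Sum>j<n. complex_of_real (A $$ (i, j)) * v $ j))"
  have "q = k * S"
    unfolding q_def S_def sum_distrib_left[of k] by (intro sum.cong) (auto simp: row)
  moreover have "cnj q = q"
  proof -
    have "cnj q = (\<Sum>i<n. \<Sum>j<n. v $ i * complex_of_real (A $$ (i, j)) * cnj (v $ j))"
      by (simp add: q_def sum_distrib_left mult.assoc)
    also have "\<dots> = (\<Sum>j<n. \<Sum>i<n. v $ i * complex_of_real (A $$ (i, j)) * cnj (v $ j))"
      by (rule sum.swap)
    also have "\<dots> = q"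
      unfolding q_def sum_distrib_left by (intro sum.cong) (auto simp: symm algebra_simps)
    finally show ?thesis .
  qed
  moreover have S: "S = complex_of_real (\<Sum>i<n. (cmod (v $ i))\<^sup>2)"
    unfolding S_def of_real_sum
    by (intro sum.cong refl) (metis complex_norm_square mult.commute of_real_power)
  moreover have "S \<noteq> 0"
  proof
    assume "S = 0"
    hence "(\<Sum>i<n. (cmod (v $ i))\<^sup>2) = 0" unfolding S of_real_eq_0_iff .
    hence "\<forall>i<n. v $ i = 0" by (subst (asm) sum_nonneg_eq_0_iff) auto
    hence "v = 0\<^sub>v n" using v by auto
    thus False using v by simp
  qed
  ultimately have "cnj k = k" by auto
  thus ?thesis by (simp add: Reals_cnj_iff)
qed

text \<open>
  The factorization over the complex numbers has only real roots, and polynomials with real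
  coefficients that agree over the complex numbers are equal.
\<close>

lemma symmetric_char_poly_splits:
  fixes A :: "real mat"
  assumes A: "A \<in> carrier_mat n n" and sym: "A\<^sup>T = A"
  obtains es where "char_poly A = (\<Prod>e\<leftarrow>es. [:- e, 1:])" and "length es = n"
proof -
  interpret map_poly_hom: map_poly_inj_idom_hom complex_of_real
    by unfold_locales auto
  let ?C = "map_mat complex_of_real A"
  have C: "?C \<in> carrier_mat n n" using A by simp
  obtain as where as: "char_poly ?C = (\<Prod>a\<leftarrow>as. [:- a, 1:])" "length as = n"
    using char_poly_factorized[OF C] by auto
  have "a \<in> \<real>" if "a \<in> set as" for a
  proof (rule symmetric_eigenvalue_real[OF A sym])
    have "poly (char_poly ?C) a = 0" unfolding as(1) using that by (rule linear_poly_root)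
    thus "eigenvalue ?C a" using eigenvalue_root_char_poly[OF C] by simp
  qed
  hence as_map: "map complex_of_real (map Re as) = as"
    by (intro nth_equalityI) auto
  have "map_poly complex_of_real (char_poly A) = char_poly ?C"
    by (rule of_real_hom.char_poly_hom[OF A, symmetric])
  also have "\<dots> = (\<Prod>a\<leftarrow>map complex_of_real (map Re as). [:- a, 1:])"
    unfolding as_map as(1) ..
  also have "\<dots> = map_poly complex_of_real (\<Prod>e\<leftarrow>map Re as. [:- e, 1:])"
    unfolding map_poly_hom.hom_prod_list by (simp add: comp_def)
  finally have "char_poly A = (\<Prod>e\<leftarrow>map Re as. [:- e, 1:])"
    by (rule map_poly_hom.injectivity)
  thus thesis using that[of "map Re as"] as(2) by simp
qed

section \<open>Positive definite matrices\<close>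

definition pos_semidef :: "nat \<Rightarrow> real mat \<Rightarrow> bool" where
  "pos_semidef n A \<longleftrightarrow> A \<in> carrier_mat n n \<and> A\<^sup>T = A \<and>
     (\<forall>x \<in> carrier_vec n. 0 \<le> x \<bullet> (A *\<^sub>v x))"

definition pos_def :: "nat \<Rightarrow> real mat \<Rightarrow> bool" where
  "pos_def n A \<longleftrightarrow> A \<in> carrier_mat n n \<and> A\<^sup>T = A \<and>
     (\<forall>x \<in> carrier_vec n. x \<noteq> 0\<^sub>v n \<longrightarrow> 0 < x \<bullet> (A *\<^sub>v x))"

lemma pos_def_imp_pos_semidef:
  assumes "pos_def n A"
  shows "pos_semidef n A"
  unfolding pos_semidef_def
proof (intro conjI ballI)
  fix x :: "real vec" assume "x \<in> carrier_vec n"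
  with assms show "0 \<le> x \<bullet> (A *\<^sub>v x)"
    by (cases "x = 0\<^sub>v n") (auto simp: pos_def_def intro: less_imp_le)
qed (use assms in \<open>auto simp: pos_def_def\<close>)

lemma pos_def_inverse_exists:
  assumes "pos_def n A"
  obtains B where "B \<in> carrier_mat n n" and "A * B = 1\<^sub>m n"
proof -
  have A: "A \<in> carrier_mat n n" using assms by (simp add: pos_def_def)
  have "det A \<noteq> 0"
  proof
    assume "det A = 0"
    then obtain v where v: "v \<in> carrier_vec n" "v \<noteq> 0\<^sub>v n" "A *\<^sub>v v = 0\<^sub>v n"
      using det_0_iff_vec_prod_zero_field[OF A] by auto
    hence "0 < v \<bullet> (A *\<^sub>v v)" using assms by (auto simp: pos_def_def)
    thus False using v by simp
  qed
  from det_non_zero_imp_unit[OF A this, of "()"] show thesis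
    using that by (auto simp: Units_def ring_mat_def)
qed

lemma symmetric_inverse:
  fixes A B :: "real mat"
  assumes A: "A \<in> carrier_mat n n" and B: "B \<in> carrier_mat n n"
    and sym: "A\<^sup>T = A" and AB: "A * B = 1\<^sub>m n"
  shows "B\<^sup>T = B"
proof -
  have "B\<^sup>T * A = 1\<^sub>m n"
    using arg_cong[OF AB, of transpose_mat] transpose_mult[OF A B] sym by simp
  hence "(B\<^sup>T * A) * B = B" using B by simp
  thus ?thesis using A B AB by (simp add: assoc_mult_mat[of _ n n _ n _ n])
qed

text \<open>
  The form of \<open>B\<close> at \<open>x = A y\<close> is the form of \<open>A\<close> at \<open>y\<close>.
\<close>

lemma pos_def_inverse:
  assumes A: "pos_def n A" and B: "B \<in> carrier_mat n n" and AB: "A * B = 1\<^sub>m n"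
  shows "pos_def n B"
  unfolding pos_def_def
proof (intro conjI ballI impI)
  have A': "A \<in> carrier_mat n n" "A\<^sup>T = A" using A by (auto simp: pos_def_def)
  show "B\<^sup>T = B" using symmetric_inverse A' B AB by blast
  fix x :: "real vec" assume x: "x \<in> carrier_vec n" "x \<noteq> 0\<^sub>v n"
  let ?y = "B *\<^sub>v x"
  have y: "?y \<in> carrier_vec n" using B x by simp
  have Ay: "A *\<^sub>v ?y = x"
    using A' B x AB by (metis assoc_mult_mat_vec one_mult_mat_vec)
  have "A *\<^sub>v 0\<^sub>v n = 0\<^sub>v n" using A' by (intro eq_vecI) auto
  hence "?y \<noteq> 0\<^sub>v n" using x Ay by auto
  hence "0 < ?y \<bullet> (A *\<^sub>v ?y)" using A y by (auto simp: pos_def_def)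
  also have "?y \<bullet> (A *\<^sub>v ?y) = x \<bullet> (B *\<^sub>v x)"
    unfolding Ay using comm_scalar_prod[OF y x(1)] by simp
  finally show "0 < x \<bullet> (B *\<^sub>v x)" .
qed (use B in simp)

lemma trace_congruence_nonneg:
  assumes "pos_semidef n P" and "M \<in> carrier_mat n n"
  shows "0 \<le> trace (M\<^sup>T * (P * M))"
proof -
  have "P \<in> carrier_mat n n" using assms by (simp add: pos_semidef_def)
  thus ?thesis
    using assms by (subst trace_transpose_mult[of _ n]) (auto simp: pos_semidef_def intro!: sum_nonneg)
qed

lemma trace_congruence_eq_0:
  assumes P: "pos_def n P" and M: "M \<in> carrier_mat n n" and "trace (M\<^sup>T * (P * M)) = 0"
  shows "M = 0\<^sub>m n n"
proof -
  have P': "P \<in> carrier_mat n n" and psd: "pos_semidef n P"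
    using P pos_def_imp_pos_semidef by (auto simp: pos_def_def)
  have "(\<Sum>i<n. col M i \<bullet> (P *\<^sub>v col M i)) = 0"
    using assms(3) trace_transpose_mult[OF M P'] by simp
  hence "\<forall>i<n. col M i \<bullet> (P *\<^sub>v col M i) = 0"
    using psd M by (subst (asm) sum_nonneg_eq_0_iff) (auto simp: pos_semidef_def)
  hence col0: "col M i = 0\<^sub>v n" if "i < n" for i
    using P M that by (metis carrier_matD(1) col_dim less_irrefl pos_def_def)
  show ?thesis
  proof (rule eq_matI)
    fix i j assume ij: "i < dim_row (0\<^sub>m n n)" "j < dim_col (0\<^sub>m n n)"
    hence "M $$ (i, j) = col M j $ i" using M by auto
    thus "M $$ (i, j) = 0\<^sub>m n n $$ (i, j)" using ij col0 by simp
  qed (use M in auto)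
qed

text \<open>
  The resolvent identity \<open>B = B' + B D B'\<close> and its transpose, inserted into each other,
  give \<open>B = B' + B' D B' + X\<^sup>T B X\<close> with \<open>X = D B'\<close>. It is the last term,
  congruent to a definite matrix, that detects whether \<open>D\<close> vanishes although \<open>D\<close>
  itself need not be definite.
\<close>

lemma trace_inverse_antimono:
  assumes A: "pos_def n A" and D: "pos_semidef n D"
    and B: "B \<in> carrier_mat n n" "A * B = 1\<^sub>m n"
    and B': "B' \<in> carrier_mat n n" "(A + D) * B' = 1\<^sub>m n"
  shows "trace B' \<le> trace B" and "trace B' = trace B \<Longrightarrow> D = 0\<^sub>m n n"
proof -
  have Ac: "A \<in> carrier_mat n n" "A\<^sup>T = A" and Dc: "D \<in> carrier_mat n n" "D\<^sup>T = D"
    using A D by (auto simp: pos_def_def pos_semidef_def)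
  have posB: "pos_def n B" using pos_def_inverse[OF A B] .
  hence symB: "B\<^sup>T = B" by (simp add: pos_def_def)
  have symB': "B'\<^sup>T = B'"
    by (rule symmetric_inverse[OF _ B'(1) _ B'(2)]) (use Ac Dc transpose_add[of A n n D] in auto)
  have BA: "B * A = 1\<^sub>m n" using mat_mult_left_right_inverse[OF Ac(1) B] .
  define X where "X = D * B'"
  have X: "X \<in> carrier_mat n n" using Dc B' by (simp add: X_def)
  have "B = B * ((A + D) * B')" using B B' by simp
  also have "(A + D) * B' = A * B' + X"
    unfolding X_def using Ac Dc B' by (simp add: add_mult_distrib_mat[of _ n n])
  also have "B * (A * B' + X) = (B * A) * B' + B * X"
    using Ac B B' X by (simp add: mult_add_distrib_mat[of _ n n _ n] assoc_mult_mat[of _ n n _ n _ n])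
  finally have B_right: "B = B' + B * X" using BA B' by simp
  have "B = (B' + B * X)\<^sup>T" using symB B_right by simp
  also have "\<dots> = B' + X\<^sup>T * B"
    using B B' X symB symB' by (simp add: transpose_add[of _ n n] transpose_mult[of _ n n _ n])
  also have "X\<^sup>T * B = X\<^sup>T * B' + X\<^sup>T * (B * X)"
    by (subst B_right) (use B B' X in \<open>simp add: mult_add_distrib_mat[of _ n n _ n]\<close>)
  also have "X\<^sup>T * B' = B'\<^sup>T * (D * B')"
    unfolding X_def using B' Dc by (simp add: transpose_mult[of _ n n _ n] assoc_mult_mat[of _ n n _ n _ n])
  finally have "trace B = trace (B' + (B'\<^sup>T * (D * B') + X\<^sup>T * (B * X)))" by simp
  also have "\<dots> = trace B' + trace (B'\<^sup>T * (D * B')) + trace (X\<^sup>T * (B * X))"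
    using B B' Dc X by (simp add: trace_add[of _ n])
  finally have key: "trace B = trace B' + trace (B'\<^sup>T * (D * B')) + trace (X\<^sup>T * (B * X))" .
  have nonneg: "0 \<le> trace (B'\<^sup>T * (D * B'))" "0 \<le> trace (X\<^sup>T * (B * X))"
    using trace_congruence_nonneg D B' X pos_def_imp_pos_semidef[OF posB] by blast+
  show "trace B' \<le> trace B" using key nonneg by simp
  assume "trace B' = trace B"
  hence "trace (X\<^sup>T * (B * X)) = 0" using key nonneg by simp
  hence X0: "D * B' = 0\<^sub>m n n" using trace_congruence_eq_0[OF posB X] by (simp add: X_def)
  have "B' * (A + D) = 1\<^sub>m n"
    by (rule mat_mult_left_right_inverse[OF _ B']) (use Ac Dc in auto)
  hence "D = D * (B' * (A + D))" using Dc by simp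
  also have "\<dots> = (D * B') * (A + D)"
    using Ac Dc B' by (simp add: assoc_mult_mat[of _ n n _ n _ n])
  also have "\<dots> = 0\<^sub>m n n" unfolding X0 using Ac Dc by (intro left_mult_zero_mat) auto
  finally show "D = 0\<^sub>m n n" .
qed

section \<open>The performance measure as a trace\<close>

definition all_ones :: "nat \<Rightarrow> real mat" where
  "all_ones n = mat n n (\<lambda>_. 1)"


text \<open>
  Determinants of \<open>(x I - L) (x I - J) = x (x I - (L + J))\<close>, evaluated at every real
  \<open>x\<close>.
\<close>

lemma char_poly_add_annihilating:
  fixes L J :: "real mat"
  assumes L: "L \<in> carrier_mat n n" and J: "J \<in> carrier_mat n n" and LJ: "L * J = 0\<^sub>m n n"
  shows "char_poly L * char_poly J = [:0, 1:] ^ n * char_poly (L + J)"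
proof -
  have "poly (char_poly L * char_poly J) x = poly ([:0, 1:] ^ n * char_poly (L + J)) x" for x
  proof -
    have eval: "poly (char_poly M) x = det (x \<cdot>\<^sub>m 1\<^sub>m n - M)" if "M \<in> carrier_mat n n" for M
      unfolding char_poly_matrix[OF that]
      by (rule arg_cong[of _ _ det], rule eq_matI) (use that in \<open>auto simp: char_matrix_def\<close>)
    have "(x \<cdot>\<^sub>m 1\<^sub>m n - L) * (x \<cdot>\<^sub>m 1\<^sub>m n - J)
        = (x \<cdot>\<^sub>m 1\<^sub>m n - L) * (x \<cdot>\<^sub>m 1\<^sub>m n) - (x \<cdot>\<^sub>m 1\<^sub>m n - L) * J"
      by (rule mult_minus_distrib_mat[of _ n n _ n]) (use L J in auto)
    also have "(x \<cdot>\<^sub>m 1\<^sub>m n - L) * J = x \<cdot>\<^sub>m J"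
      by (subst minus_mult_distrib_mat[of _ n n]) (use L J LJ in \<open>auto simp: mult_smult_assoc_mat[of _ n n]\<close>)
    also have "(x \<cdot>\<^sub>m 1\<^sub>m n - L) * (x \<cdot>\<^sub>m 1\<^sub>m n) = x \<cdot>\<^sub>m (x \<cdot>\<^sub>m 1\<^sub>m n - L)"
      by (subst mult_smult_distrib[of _ n n _ n]) (use L in auto)
    also have "x \<cdot>\<^sub>m (x \<cdot>\<^sub>m 1\<^sub>m n - L) - x \<cdot>\<^sub>m J = x \<cdot>\<^sub>m (x \<cdot>\<^sub>m 1\<^sub>m n - (L + J))"
      by (rule eq_matI) (use L J in \<open>auto simp: algebra_simps\<close>)
    finally have "det (x \<cdot>\<^sub>m 1\<^sub>m n - L) * det (x \<cdot>\<^sub>m 1\<^sub>m n - J) = x ^ n * det (x \<cdot>\<^sub>m 1\<^sub>m n - (L + J))"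
      using L J det_mult[of "x \<cdot>\<^sub>m 1\<^sub>m n - L" n "x \<cdot>\<^sub>m 1\<^sub>m n - J"]
      by (simp add: minus_carrier_mat)
    thus ?thesis using L J by (simp add: eval poly_power)
  qed
  thus ?thesis by (simp add: poly_eq_poly_eq_iff[symmetric] fun_eq_iff)
qed

lemma proots_linear_factors:
  "proots (\<Prod>e\<leftarrow>es. [:- e, 1:]) = (mset es :: real multiset)"
proof (induction es)
  case (Cons a es)
  have "(\<Prod>e\<leftarrow>es. [:- e, 1:]) \<noteq> (0 :: real poly)"
    by (auto simp: prod_list_zero_iff)
  hence "proots ([:- a, 1:] * (\<Prod>e\<leftarrow>es. [:- e, 1:])) = {#a#} + mset es"
    using Cons.IH by (subst proots_mult) auto
  thus ?case by simp
qed simp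

text \<open>
  The \<open>n\<close> roots by which the two sides of the previous factorization differ are all zero,
  and the library value \<open>inverse 0 = 0\<close> makes them invisible here.
\<close>

lemma sum_inverse_roots_add_annihilating:
  fixes L J :: "real mat"
  assumes L: "L \<in> carrier_mat n n" and J: "J \<in> carrier_mat n n" and LJ: "L * J = 0\<^sub>m n n"
  shows "(\<Sum>e\<in>#proots (char_poly (L + J)). inverse e) =
    (\<Sum>e\<in>#proots (char_poly L). inverse e) + (\<Sum>e\<in>#proots (char_poly J). inverse e)"
proof -
  have nz: "char_poly M \<noteq> 0" if "M \<in> carrier_mat n n" for M :: "real mat"
    using degree_monic_char_poly[OF that] by auto
  have "proots (char_poly L) + proots (char_poly J) =
      repeat_mset n {#0#} + proots (char_poly (L + J))"
    using arg_cong[OF char_poly_add_annihilating[OF assms], of proots] L J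
    by (simp add: proots_mult nz proots_power)
  from arg_cong[OF this, of "\<lambda>R. \<Sum>e\<in>#R. inverse e"]
  have "(\<Sum>e\<in>#proots (char_poly L). inverse e) + (\<Sum>e\<in>#proots (char_poly J). inverse e) =
      (\<Sum>e\<in>#repeat_mset n {#0 :: real#}. inverse e) + (\<Sum>e\<in>#proots (char_poly (L + J)). inverse e)"
    by simp
  moreover have "(\<Sum>e\<in>#repeat_mset n {#0 :: real#}. inverse e) = 0"
    by (induction n) simp_all
  ultimately show ?thesis by simp
qed

lemma sum_inverse_eq_sum_tail:
  fixes xs :: "real list"
  assumes "xs \<noteq> []" "xs ! 0 = 0"
  shows "(\<Sum>x\<leftarrow>xs. inverse x) = (\<Sum>i = 2..length xs. inverse (xs ! (i - 1)))"
proof -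
  have "(\<Sum>x\<leftarrow>xs. inverse x) = (\<Sum>i<length xs. inverse (xs ! i))"
    by (simp add: sum_list_sum_nth atLeast0LessThan)
  also have "\<dots> = (\<Sum>i\<in>{1..<length xs}. inverse (xs ! i))"
    by (rule sum.mono_neutral_right) (use assms in \<open>auto simp: Suc_le_eq\<close>)
  also have "\<dots> = (\<Sum>i = 2..length xs. inverse (xs ! (i - 1)))"
    by (rule sum.reindex_bij_witness[of _ "\<lambda>i. i - 1" Suc]) auto
  finally show ?thesis .
qed

text \<open>
  The performance measure skips the first entry of the sorted eigenvalue list. That entry is
  \<open>0\<close>, since the all-ones vector is in the kernel and no eigenvalue of a semidefinite
  matrix is negative, so the sum may be taken over all eigenvalues. The term subtracted from the
  trace depends on \<open>n\<close> only and cancels whenever two graphs on the same nodes are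
  compared.
\<close>

lemma rho_ss_centered_eq_trace:
  assumes L: "pos_semidef n L" and n: "0 < n" and LJ: "L * all_ones n = 0\<^sub>m n n"
    and B: "B \<in> carrier_mat n n" "(L + all_ones n) * B = 1\<^sub>m n"
  shows "rho_ss_centered L =
    1 / 2 * (trace B - (\<Sum>e\<in>#proots (char_poly (all_ones n)). inverse e))"
proof -
  have Lc: "L \<in> carrier_mat n n" "L\<^sup>T = L" using L by (auto simp: pos_semidef_def)
  have J: "all_ones n \<in> carrier_mat n n" "(all_ones n)\<^sup>T = all_ones n"
    by (auto simp: all_ones_def intro!: eq_matI)
  obtain es where es: "char_poly L = (\<Prod>e\<leftarrow>es. [:- e, 1:])" "length es = n"
    using symmetric_char_poly_splits[OF Lc] .
  have LJc: "L + all_ones n \<in> carrier_mat n n" "(L + all_ones n)\<^sup>T = L + all_ones n"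
    using Lc J transpose_add[of L n n "all_ones n"] by auto
  obtain fs where fs: "char_poly (L + all_ones n) = (\<Prod>e\<leftarrow>fs. [:- e, 1:])"
    using symmetric_char_poly_splits[OF LJc] .
  have roots: "set es = {e. eigenvalue L e}"
    using eigenvalue_root_char_poly[OF Lc(1)] unfolding es(1)
    by (auto simp: poly_prod_list prod_list_zero_iff)
  have nonneg: "0 \<le> e" if "e \<in> set es" for e
  proof -
    have "eigenvalue L e" using that roots by simp
    then obtain v where v: "v \<in> carrier_vec n" "v \<noteq> 0\<^sub>v n" "L *\<^sub>v v = e \<cdot>\<^sub>v v"
      using Lc by (auto simp: eigenvalue_def eigenvector_def)
    have "0 \<le> v \<bullet> (L *\<^sub>v v)" using L v by (auto simp: pos_semidef_def)
    also have "\<dots> = e * (v \<bullet> v)" using v by simp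
    finally have "0 \<le> e * (v \<bullet> v)" .
    moreover have "0 < v \<bullet> v"
      using v conjugate_square_greater_0_vec[of v n] by simp
    ultimately show ?thesis by (simp add: zero_le_mult_iff)
  qed
  have zero: "0 \<in> set es"
  proof -
    let ?v = "col (all_ones n) 0"
    have "L *\<^sub>v ?v = col (L * all_ones n) 0" using Lc J n by (intro eq_vecI) auto
    also have "\<dots> = 0 \<cdot>\<^sub>v ?v" unfolding LJ using n by (intro eq_vecI) (auto simp: all_ones_def)
    finally have "L *\<^sub>v ?v = 0 \<cdot>\<^sub>v ?v" .
    moreover have "?v \<noteq> 0\<^sub>v n"
    proof
      assume "?v = 0\<^sub>v n"
      hence "?v $ 0 = 0\<^sub>v n $ 0" by simp
      thus False using n by (simp add: all_ones_def)
    qed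
    moreover have "?v \<in> carrier_vec n" by (simp add: all_ones_def carrier_vecI)
    ultimately have "eigenvalue L 0" using Lc by (auto simp: eigenvalue_def eigenvector_def)
    thus ?thesis using roots by simp
  qed
  have list: "eigenvalue_list L = sort es"
    by (simp add: eigenvalue_list_def es(1) proots_linear_factors)
  have least: "sort es ! 0 = 0"
  proof -
    obtain i where i: "i < length (sort es)" "sort es ! i = 0"
      using zero by (metis in_set_conv_nth set_sort)
    hence "sort es ! 0 \<le> 0" using sorted_nth_mono[of "sort es" 0 i] by simp
    moreover have "0 \<le> sort es ! 0" using nonneg n es(2) by (metis length_sort nth_mem set_sort)
    ultimately show ?thesis by simp
  qed
  have "(\<Sum>i = 2..dim_row L. inverse (eigenvalue_list L ! (i - 1))) = (\<Sum>e\<leftarrow>sort es. inverse e)"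
  proof -
    have "sort es \<noteq> []" using n es(2) by (metis length_sort length_greater_0_conv)
    thus ?thesis
      using sum_inverse_eq_sum_tail[of "sort es"] least Lc es(2) by (simp add: list)
  qed
  also have "\<dots> = (\<Sum>e\<in>#mset (sort es). inverse e)" by (metis mset_map sum_mset_sum_list)
  also have "\<dots> = (\<Sum>e\<in>#proots (char_poly L). inverse e)"
    by (simp add: es(1) proots_linear_factors)
  also have "\<dots> = (\<Sum>e\<leftarrow>fs. inverse e) - (\<Sum>e\<in>#proots (char_poly (all_ones n)). inverse e)"
    using sum_inverse_roots_add_annihilating[OF Lc(1) J(1) LJ]
    by (simp add: fs proots_linear_factors) (metis mset_map sum_mset_sum_list add_diff_cancel_right')
  also have "(\<Sum>e\<leftarrow>fs. inverse e) = trace B"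
    using trace_inverse_eq_sum_inverse_roots[OF LJc(1) B fs] by simp
  finally show ?thesis by (simp add: rho_ss_centered_def)
qed

section \<open>Graph Laplacians\<close>

text \<open>
  Laplacian of an arbitrary weight function on pairs of nodes. Unlike the Laplacian of a graph it is
  linear in the weights, so that the difference of two graph Laplacians is again of this form.
  Diagonal weights cancel.
\<close>

definition weight_laplacian :: "nat \<Rightarrow> (nat \<Rightarrow> nat \<Rightarrow> real) \<Rightarrow> real mat" where
  "weight_laplacian n a =
     mat n n (\<lambda>(i, j). (if i = j then \<Sum>k<n. a i k else 0) - a i j)"

lemma weight_nonneg:
  assumes "weighted_graph n G"
  shows "0 \<le> weight G e"
  using assms by (cases "e \<in> edges G") (auto simp: weighted_graph_def intro: less_imp_le)

text \<open>
  The edges at \<open>i\<close> correspond to their other endpoints, and weights vanish off the edge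
  set, so the degree is a sum over all nodes.
\<close>

lemma laplacian_eq_weight_laplacian:
  assumes "weighted_graph n G"
  shows "laplacian n G = weight_laplacian n (\<lambda>i j. weight G {i, j})"
proof -
  have sub: "edges G \<subseteq> {{u, v} | u v. u < n \<and> v < n \<and> u \<noteq> v}"
    using assms by (simp add: weighted_graph_def)
  have off: "weight G e = 0" if "e \<notin> edges G" for e
    using that assms by (simp add: weighted_graph_def)
  have degree: "(\<Sum>e\<in>{e \<in> edges G. i \<in> e}. weight G e) = (\<Sum>k<n. weight G {i, k})" if i: "i < n" for i
  proof -
    have inj: "inj_on (\<lambda>k. {i, k}) {..<n}" by (auto simp: inj_on_def doubleton_eq_iff)
    have "(\<Sum>k<n. weight G {i, k}) = (\<Sum>e\<in>(\<lambda>k. {i, k}) ` {..<n}. weight G e)"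
      by (simp add: sum.reindex[OF inj])
    also have "\<dots> = (\<Sum>e\<in>{e \<in> edges G. i \<in> e}. weight G e)"
    proof (rule sum.mono_neutral_right)
      show "{e \<in> edges G. i \<in> e} \<subseteq> (\<lambda>k. {i, k}) ` {..<n}" using sub by fastforce
    qed (auto intro: off)
    finally show ?thesis by simp
  qed
  show ?thesis
    by (rule eq_matI)
      (auto simp: laplacian_def degree_mat_def adjacency_mat_def mat_diag_def weight_laplacian_def degree off)
qed

lemma weight_laplacian_diff:
  "weight_laplacian n a - weight_laplacian n b = weight_laplacian n (\<lambda>i j. a i j - b i j)"
  by (rule eq_matI) (auto simp: weight_laplacian_def sum_subtractf)

lemma weight_laplacian_quadratic_form:
  assumes sym: "\<And>i j. a i j = a j i" and x: "x \<in> carrier_vec n"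
  shows "x \<bullet> (weight_laplacian n a *\<^sub>v x) = 1 / 2 * (\<Sum>i<n. \<Sum>j<n. a i j * (x $ i - x $ j)\<^sup>2)"
proof -
  have "x \<bullet> (weight_laplacian n a *\<^sub>v x) =
      (\<Sum>i<n. x $ i * (\<Sum>j<n. ((if i = j then \<Sum>k<n. a i k else 0) - a i j) * x $ j))"
    using x by (auto simp: scalar_prod_def weight_laplacian_def atLeast0LessThan intro!: sum.cong)
  also have "\<dots> = (\<Sum>i<n. x $ i * ((\<Sum>k<n. a i k) * x $ i - (\<Sum>j<n. a i j * x $ j)))"
  proof (intro sum.cong refl arg_cong[of _ _ "(*) _"])
    fix i assume "i \<in> {..<n}"
    have "((if i = j then \<Sum>k<n. a i k else 0) - a i j) * x $ j =
        (if i = j then (\<Sum>k<n. a i k) * x $ j else 0) - a i j * x $ j" for j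
      by (simp add: algebra_simps)
    thus "(\<Sum>j<n. ((if i = j then \<Sum>k<n. a i k else 0) - a i j) * x $ j) =
        (\<Sum>k<n. a i k) * x $ i - (\<Sum>j<n. a i j * x $ j)"
      using \<open>i \<in> {..<n}\<close> by (simp add: sum_subtractf)
  qed
  also have "\<dots> = (\<Sum>i<n. \<Sum>j<n. a i j * (x $ i)\<^sup>2) - (\<Sum>i<n. \<Sum>j<n. a i j * (x $ i * x $ j))"
    unfolding sum_subtractf[symmetric]
    by (intro sum.cong refl)
      (simp add: right_diff_distrib sum_subtractf sum_distrib_left sum_distrib_right power2_eq_square ac_simps)
  finally have form: "x \<bullet> (weight_laplacian n a *\<^sub>v x) =
      (\<Sum>i<n. \<Sum>j<n. a i j * (x $ i)\<^sup>2) - (\<Sum>i<n. \<Sum>j<n. a i j * (x $ i * x $ j))" .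
  have swap: "(\<Sum>i<n. \<Sum>j<n. a i j * (x $ j)\<^sup>2) = (\<Sum>i<n. \<Sum>j<n. a i j * (x $ i)\<^sup>2)"
    by (subst sum.swap) (simp add: sym)
  have "(\<Sum>i<n. \<Sum>j<n. a i j * (x $ i - x $ j)\<^sup>2) =
      (\<Sum>i<n. \<Sum>j<n. a i j * (x $ i)\<^sup>2) + (\<Sum>i<n. \<Sum>j<n. a i j * (x $ j)\<^sup>2)
        - 2 * (\<Sum>i<n. \<Sum>j<n. a i j * (x $ i * x $ j))"
  proof -
    have "a i j * (x $ i - x $ j)\<^sup>2 =
        a i j * (x $ i)\<^sup>2 + a i j * (x $ j)\<^sup>2 - 2 * (a i j * (x $ i * x $ j))" for i j
      by (simp add: power2_eq_square algebra_simps)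
    thus ?thesis by (simp add: sum.distrib sum_subtractf sum_distrib_left)
  qed
  thus ?thesis unfolding form swap by simp
qed

lemma weight_laplacian_symmetric:
  assumes "\<And>i j. a i j = a j i"
  shows "(weight_laplacian n a)\<^sup>T = weight_laplacian n a"
  by (rule eq_matI) (auto simp: weight_laplacian_def assms)

lemma weight_laplacian_pos_semidef:
  assumes sym: "\<And>i j. a i j = a j i" and nonneg: "\<And>i j. 0 \<le> a i j"
  shows "pos_semidef n (weight_laplacian n a)"
  unfolding pos_semidef_def
proof (intro conjI ballI)
  fix x :: "real vec" assume "x \<in> carrier_vec n"
  thus "0 \<le> x \<bullet> (weight_laplacian n a *\<^sub>v x)"
    using nonneg by (auto simp: weight_laplacian_quadratic_form[of a, OF sym] intro!: sum_nonneg)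
next
  show "(weight_laplacian n a)\<^sup>T = weight_laplacian n a"
    by (rule weight_laplacian_symmetric[of a, OF sym])
qed (simp add: weight_laplacian_def)

lemma weight_laplacian_mult_all_ones:
  "weight_laplacian n a * all_ones n = 0\<^sub>m n n"
  by (rule eq_matI)
    (auto simp: weight_laplacian_def all_ones_def scalar_prod_def sum_subtractf atLeast0LessThan)

text \<open>
  If the form of \<open>L + J\<close> vanishes at \<open>x\<close>, then so do both nonnegative summands. The
  first says that \<open>x\<close> agrees at the ends of every edge, hence is constant by connectedness;
  the second says that its coordinates sum to \<open>0\<close>.
\<close>

lemma laplacian_add_all_ones_pos_def:
  assumes G: "weighted_graph n G" and conn: "connected_graph n G"
  shows "pos_def n (laplacian n G + all_ones n)"
proof -
  define a where "a = (\<lambda>i j. weight G {i, j})"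
  have sym: "a i j = a j i" for i j by (simp add: a_def insert_commute)
  have nonneg: "0 \<le> a i j" for i j
    using weight_nonneg[OF G] by (simp add: a_def)
  have L: "laplacian n G = weight_laplacian n a"
    unfolding a_def by (rule laplacian_eq_weight_laplacian[OF G])
  have Lc: "weight_laplacian n a \<in> carrier_mat n n" by (simp add: weight_laplacian_def)
  have J: "all_ones n \<in> carrier_mat n n" "(all_ones n)\<^sup>T = all_ones n"
    by (auto simp: all_ones_def intro!: eq_matI)
  show ?thesis
    unfolding pos_def_def L
  proof (intro conjI ballI impI)
    show "(weight_laplacian n a + all_ones n)\<^sup>T = weight_laplacian n a + all_ones n"
      using transpose_add[OF Lc J(1)] weight_laplacian_symmetric[of a, OF sym] J by simp
    fix x :: "real vec" assume x: "x \<in> carrier_vec n" "x \<noteq> 0\<^sub>v n"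
    let ?L = "x \<bullet> (weight_laplacian n a *\<^sub>v x)"
    have "x \<bullet> (all_ones n *\<^sub>v x) = (\<Sum>i<n. x $ i)\<^sup>2"
      using x by (auto simp: scalar_prod_def all_ones_def atLeast0LessThan power2_eq_square
        sum_distrib_right intro!: sum.cong)
    hence form: "x \<bullet> ((weight_laplacian n a + all_ones n) *\<^sub>v x) = ?L + (\<Sum>i<n. x $ i)\<^sup>2"
      using x Lc J by (simp add: add_mult_distrib_mat_vec[of _ n n] scalar_prod_add_distrib[of _ n])
    have L_nonneg: "0 \<le> ?L"
      using weight_laplacian_pos_semidef[of a n, OF sym nonneg] x by (simp add: pos_semidef_def)
    have "?L + (\<Sum>i<n. x $ i)\<^sup>2 \<noteq> 0"
    proof
      assume "?L + (\<Sum>i<n. x $ i)\<^sup>2 = 0"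
      hence L0: "?L = 0" and sum0: "(\<Sum>i<n. x $ i) = 0"
        using L_nonneg by (auto simp: add_nonneg_eq_0_iff)
      have "(\<Sum>i<n. \<Sum>j<n. a i j * (x $ i - x $ j)\<^sup>2) = 0"
        using L0 weight_laplacian_quadratic_form[of a, OF sym x(1)] by simp
      hence terms: "a i j * (x $ i - x $ j)\<^sup>2 = 0" if "i < n" "j < n" for i j
        using that nonneg by (auto simp: sum_nonneg_eq_0_iff sum_nonneg)
      have edge: "x $ u = x $ v" if "{u, v} \<in> edges G" for u v
      proof -
        have "u < n" "v < n" "0 < a u v"
          using that G by (auto simp: weighted_graph_def a_def doubleton_eq_iff)
        thus ?thesis using terms[of u v] by simp
      qed
      have path: "x $ u = x $ v" if "(u, v) \<in> {(p, q). {p, q} \<in> edges G}\<^sup>*" for u v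
        using that by induction (auto dest: edge)
      have n: "0 < n" using conn by (simp add: connected_graph_def)
      have const: "x $ i = x $ 0" if "i < n" for i
        using conn n that path[of i 0] unfolding connected_graph_def by blast
      have "(\<Sum>i<n. x $ i) = (\<Sum>i<n. x $ 0)" by (intro sum.cong refl const) simp
      hence "x $ 0 = 0" using sum0 n by simp
      hence "x $ i = 0" if "i < n" for i using const[OF that] by (rule trans[rotated])
      hence "x = 0\<^sub>v n" using x by auto
      thus False using x by simp
    qed
    thus "0 < x \<bullet> ((weight_laplacian n a + all_ones n) *\<^sub>v x)"
      using L_nonneg by (simp add: form less_le)
  qed (use Lc J in simp)
qed

theorem theorem15:
  fixes n :: nat and G P :: wgraph
  assumes "weighted_graph n G" and "connected_graph n G"
    and "weighted_graph n P" and "connected_graph n P"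
    and "spanning_subgraph P G"
  shows "rho_ss_centered (laplacian n G) \<le> rho_ss_centered (laplacian n P) \<and>
    (rho_ss_centered (laplacian n G) = rho_ss_centered (laplacian n P) \<longleftrightarrow> G = P)"
proof -
  define g where "g = (\<lambda>i j. weight G {i, j})"
  define p where "p = (\<lambda>i j. weight P {i, j})"
  define D where "D = weight_laplacian n (\<lambda>i j. g i j - p i j)"
  have le: "weight P e \<le> weight G e" for e
    using assms(1,3,5) unfolding weighted_graph_def spanning_subgraph_def
    by (cases "e \<in> edges P"; cases "e \<in> edges G") (auto intro: less_imp_le)
  have LG: "laplacian n G = weight_laplacian n g" and LP: "laplacian n P = weight_laplacian n p"
    using laplacian_eq_weight_laplacian assms(1,3) by (auto simp: g_def p_def)
  have psd: "pos_semidef n (laplacian n G)" "pos_semidef n (laplacian n P)" "pos_semidef n D"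
    unfolding LG LP D_def
    by (rule weight_laplacian_pos_semidef;
      simp add: g_def p_def insert_commute le weight_nonneg[OF assms(1)] weight_nonneg[OF assms(3)])+
  \<comment> \<open>The difference of the two Laplacians is the Laplacian of the nonnegative weights added to \<open>P\<close>.\<close>
  have shift: "laplacian n G + all_ones n = (laplacian n P + all_ones n) + D"
    unfolding D_def LG LP weight_laplacian_diff[symmetric]
    by (rule eq_matI) (auto simp: weight_laplacian_def all_ones_def)
  have n: "0 < n" using assms(2) by (simp add: connected_graph_def)
  have posG: "pos_def n (laplacian n G + all_ones n)" and posP: "pos_def n (laplacian n P + all_ones n)"
    using laplacian_add_all_ones_pos_def assms(1-4) by blast+
  obtain B where B: "B \<in> carrier_mat n n" "(laplacian n P + all_ones n) * B = 1\<^sub>m n"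
    using pos_def_inverse_exists[OF posP] .
  obtain B' where B': "B' \<in> carrier_mat n n" "(laplacian n G + all_ones n) * B' = 1\<^sub>m n"
    using pos_def_inverse_exists[OF posG] .
  have ann: "laplacian n G * all_ones n = 0\<^sub>m n n" "laplacian n P * all_ones n = 0\<^sub>m n n"
    unfolding LG LP by (rule weight_laplacian_mult_all_ones)+
  note rho = rho_ss_centered_eq_trace[OF psd(1) n ann(1) B'] rho_ss_centered_eq_trace[OF psd(2) n ann(2) B]
  note mono = trace_inverse_antimono[OF posP psd(3) B B'[unfolded shift]]
  have "G = P" if "rho_ss_centered (laplacian n G) = rho_ss_centered (laplacian n P)"
  proof -
    \<comment> \<open>Off-diagonal entries of \<open>D\<close> are the negated weight differences.\<close>
    have D0: "D = 0\<^sub>m n n" using that rho mono(2) by simp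
    have same: "weight G e = weight P e" for e
    proof (cases "e \<in> edges G")
      case True
      then obtain u v where uv: "e = {u, v}" "u < n" "v < n" "u \<noteq> v"
        using assms(1) by (auto simp: weighted_graph_def)
      thus ?thesis
        using arg_cong[OF D0, of "\<lambda>M. M $$ (u, v)"] by (simp add: D_def weight_laplacian_def g_def p_def)
    next
      case False
      thus ?thesis using le[of e] weight_nonneg[OF assms(3), of e] assms(1) by (auto simp: weighted_graph_def)
    qed
    \<comment> \<open>Edge sets are recovered from the weights as the pairs of positive weight.\<close>
    have "edges G = edges P"
    proof -
      have "e \<in> edges H \<longleftrightarrow> 0 < weight H e" if "weighted_graph n H" for e H
        using that by (cases "e \<in> edges H") (auto simp: weighted_graph_def)
      thus ?thesis using assms(1,3) same by auto
    qed
    thus ?thesis using same by (intro wgraph.equality) auto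
  qed
  thus ?thesis using rho mono(1) by auto
qed

end
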